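(* Let $n,m\in\omega$ with $m>0$, and let $(X,d)$ be an $\infty$-pseudometric space. If $X$ has an integral APD profile of the form $(n+1,\alpha_1,\dots,\alpha_m)$ for some non-decreasing functions $\alpha_1,\dots,\alpha_m\colon\mathbb{N}\to\mathbb{N}$, then $\mathrm{trasdim}\,(X,d)\leq m\cdot\omega+n$, where $m\cdot\omega$ denotes the ordinal sum $\omega+\dots+\omega$ of $m$ copies of $\omega$.
   Context: $\mathbb{N}$ is the set of positive integers and $\omega=\{0,1,2,\dots\}$. An $\infty$-pseudometric space is a set $X$ with a function $d\colon X\times X\to[0,\infty]$ that is symmetric, satisfies the triangle inequality and vanishes on the diagonal. Subsets of $X$ are regarded as subspaces with the restricted $d$. A family $\mathcal{U}$ of subspaces is uniformly bounded if $\mathrm{mesh}(\mathcal{U})=\sup\{\mathrm{diam}(U)\colon U\in\mathcal{U}\}$ is finite (with $\sup\emptyset=0$). For $r>0$, $\mathcal{U}$ is $r$-disjoint if $\mathrm{dist}(A,B)=\inf\{d(a,b)\colon a\in A,b\in B\}\geq r$ for any different $A,B\in\mathcal{U}$. Scale-$r$-dimension. For $x\in X$ and $r>0$, the scale-$r$-component of $x$ in $X$ is the set of all $y\in X$ for which there is a finite sequence $y=x_0,\dots,x_n=x$ in $X$ with $B(x_i,r)\cap B(x_{i+1},r)\neq\emptyset$ for each $0\leq i<n$, where $B(x,r)=\{z\in X\colon d(x,z)<r\}$ is the open ball in $X$. $X$ is of scale-$r$-dimension $0$ if the family of its scale-$r$-components is uniformly bounded. $X$ is of scale-$r$-dimension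 at most $n$ if it is the union of some $n+1$ subspaces of scale-$r$-dimension $0$ (components and balls of a subspace being taken inside that subspace). Integral APD profile. A finite array of non-decreasing functions $(\alpha_0,\dots,\alpha_k)$ from $\mathbb{N}$ to $\mathbb{N}$ is an integral APD profile of $X$ if $\alpha_0$ is constant (identified with its value) and for any non-decreasing array $(r_0,\dots,r_k)$ of positive integers there is a decomposition of $X$ as the union of subsets $X_0,\dots,X_k$ such that $X_i$ has scale-$r_i$-dimension at most $\alpha_i(r_{i-1})-1$ for $1\leq i\leq k$, and $X_0$ has scale-$r_0$-dimension at most $\alpha_0-1$. Ordinal number $\mathrm{Ord}$. For a set $L$, $\mathrm{Fin}\,L$ is the family of all finite non-empty subsets of $L$. For $M\subset\mathrm{Fin}\,L$ and $a\in L$ put $M^a=\{\tau\in\mathrm{Fin}\,L\colon \tau\cup\{a\}\in M,\ a\notin\tau\}$. Define $\mathrm{Ord}\,M$ inductively: $\mathrm{Ord}\,M=0$ iff $M=\emptyset$; for an ordinal $\alpha>0$, $\mathrm{Ord}\,M\leq\alpha$ iff $\mathrm{Ord}\,M^a<\alpha$ for every $a\in L$; $\mathrm{Ord}\,M=\alpha$ iff $\mathrm{Ord}\,M\leq\alpha$ and $\mathrm{Ord}\,M<\alpha$ is not true; $\mathrm{Ord}\,M=\infty$ iff $\mathrm{Ord}\,M>\alpha$ for every ordinal $\alpha$. Transfinite asymptotic dimension. Let $\mathcal{A}(X,d)$ be the set of all $\sigma\in\mathrm{Fin}\,\mathbb{N}$ such that there is no family $(X_i)_{i\in\sigma}$ of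 subspaces of $X$ which covers $X$ and in which each $X_i$ is the union of some $i$-disjoint uniformly bounded family. Let $M(X,d)$ be the set of all $\sigma\in\mathrm{Fin}\,\mathbb{N}$ such that there is no family $(X_i)_{i\in\sigma}$ of subspaces of $X$ which covers $X$ and in which each $X_i$ has scale-$i$-dimension $0$. One has $\mathrm{Ord}\,\mathcal{A}(X,d)=\mathrm{Ord}\,M(X,d)$, and this common value is $\mathrm{trasdim}\,(X,d)$. *)

theory Defs
  imports
    "HOL-Library.Extended_Nonnegative_Real"
    "HOL-Library.Extended"
    "HOL-Library.Nat_Bijection"
begin

section \<open>Countable ordinals\<close>

unbundle cardinal_syntax

text \<open>An ordinal is an isomorphism class of well-orders. Well-orders on sets of natural numbers
  represent exactly the countable ordinals.\<close>

quotient_type ordinal = "nat rel" / partial: "\<lambda>r s. r =o s"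
proof (rule part_equivpI)
  show "\<exists>r::nat rel. r =o r"
    using natLeq_Well_order ordIso_reflexive by blast
  show "symp (\<lambda>r s::nat rel. r =o s)"
    by (auto intro!: sympI ordIso_symmetric)
  show "transp (\<lambda>r s::nat rel. r =o s)"
    by (auto intro!: transpI intro: ordIso_transitive)
qed

lemma ordIso_refl_iff: "r =o r \<longleftrightarrow> Well_order r"
  using ordIso_reflexive by (auto simp: ordIso_def)

lemma ordIso_ordLeq_cong: "r =o r' \<Longrightarrow> s =o s' \<Longrightarrow> r \<le>o s \<longleftrightarrow> r' \<le>o s'"
  using ordIso_ordLeq_trans[of r' r s] ordIso_ordLeq_trans[of r r' s']
    ordLeq_ordIso_trans[of r' s s'] ordLeq_ordIso_trans[of r s' s]
  by (auto dest: ordIso_symmetric)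

lemma ordIso_ordLess_cong: "r =o r' \<Longrightarrow> s =o s' \<Longrightarrow> r <o s \<longleftrightarrow> r' <o s'"
  using ordIso_ordLess_trans[of r' r s] ordIso_ordLess_trans[of r r' s']
    ordLess_ordIso_trans[of r' s s'] ordLess_ordIso_trans[of r s' s]
  by (auto dest: ordIso_symmetric)

instantiation ordinal :: wellorder
begin

lift_definition less_eq_ordinal :: "ordinal \<Rightarrow> ordinal \<Rightarrow> bool" is "\<lambda>r s. r \<le>o s"
  by (rule ordIso_ordLeq_cong)

lift_definition less_ordinal :: "ordinal \<Rightarrow> ordinal \<Rightarrow> bool" is "\<lambda>r s. r <o s"
  by (rule ordIso_ordLess_cong)

instance
proof
  fix x y z :: ordinal
  show "x < y \<longleftrightarrow> x \<le> y \<and> \<not> y \<le> x"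
    by transfer (simp add: ordIso_refl_iff, metis not_ordLeq_iff_ordLess ordLess_imp_ordLeq)
  show "x \<le> x"
    by transfer (simp add: ordLeq_iff_ordLess_or_ordIso)
  show "x \<le> y \<Longrightarrow> y \<le> z \<Longrightarrow> x \<le> z"
    by transfer (rule ordLeq_transitive)
  show "x \<le> y \<Longrightarrow> y \<le> x \<Longrightarrow> x = y"
    by transfer (simp add: ordIso_iff_ordLeq)
  show "x \<le> y \<or> y \<le> x"
    by transfer (simp add: ordIso_refl_iff ordLeq_total)
next
  fix P :: "ordinal \<Rightarrow> bool" and a :: ordinal
  assume step: "\<And>x. (\<And>y. y < x \<Longrightarrow> P y) \<Longrightarrow> P x"
  have rep: "rep_ordinal y =o rep_ordinal y" "abs_ordinal (rep_ordinal y) = y" for y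
    by (rule Quotient3_rep_reflp[OF Quotient3_ordinal] Quotient3_abs_rep[OF Quotient3_ordinal])+
  have *: "r =o r \<longrightarrow> P (abs_ordinal r)" for r
  proof (induction r rule: wf_induct_rule[OF wf_ordLess])
    case (1 r)
    show ?case
    proof (rule impI, rule step)
      fix y assume r: "r =o r" and "y < abs_ordinal r"
      then have "abs_ordinal (rep_ordinal y) < abs_ordinal r"
        by (simp only: rep(2))
      then have "rep_ordinal y <o r"
        using less_ordinal.abs_eq[OF rep(1) r] by simp
      from 1[OF this] show "P y"
        by (simp only: rep(2) rep(1)[THEN eqTrueI] simp_thms)
    qed
  qed
  show "P a"
    using *[of "rep_ordinal a"] by (simp only: rep(2) rep(1)[THEN eqTrueI] simp_thms)
qed

end

lift_definition ord_of_nat :: "nat \<Rightarrow> ordinal" is "\<lambda>n. natLeq_on n"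
  by (simp add: natLeq_on_Well_order ordIso_reflexive)

lift_definition omega :: ordinal is natLeq
  by (simp add: natLeq_Well_order ordIso_reflexive)

text \<open>The ordinal sum of two well-orders: everything in \<open>r\<close> precedes everything in \<open>s\<close>.\<close>

definition ord_sum :: "'a rel \<Rightarrow> 'b rel \<Rightarrow> ('a + 'b) rel" where
  "ord_sum r s = {(Inl x, Inl y) | x y. (x, y) \<in> r}
     \<union> {(Inl x, Inr y) | x y. x \<in> Field r \<and> y \<in> Field s}
     \<union> {(Inr x, Inr y) | x y. (x, y) \<in> s}"

lemma ord_sum_iff [simp]:
  "(Inl x, Inl y) \<in> ord_sum r s \<longleftrightarrow> (x, y) \<in> r"
  "(Inr x', Inr y') \<in> ord_sum r s \<longleftrightarrow> (x', y') \<in> s"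
  "(Inl x, Inr y') \<in> ord_sum r s \<longleftrightarrow> x \<in> Field r \<and> y' \<in> Field s"
  "(Inr x', Inl y) \<notin> ord_sum r s"
  by (auto simp: ord_sum_def)

lemma Field_iff: "a \<in> Field R \<longleftrightarrow> (\<exists>b. (a, b) \<in> R \<or> (b, a) \<in> R)"
  by (auto simp: Field_def)

lemma Field_ord_sum: "Field (ord_sum r s) = Inl ` Field r \<union> Inr ` Field s"
proof (rule set_eqI)
  fix z show "z \<in> Field (ord_sum r s) \<longleftrightarrow> z \<in> Inl ` Field r \<union> Inr ` Field s"
    by (cases z) (auto simp: Field_iff split_sum_ex image_iff)
qed

lemma Well_order_ord_sum:
  assumes r: "Well_order r" and s: "Well_order s"
  shows "Well_order (ord_sum r s)"
proof -
  note wo_defs = well_order_on_def linear_order_on_def partial_order_on_def preorder_on_def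
  have R: "refl_on (Field r) r" "trans r" "antisym r" "total_on (Field r) r" "wf (r - Id)"
    and S: "refl_on (Field s) s" "trans s" "antisym s" "total_on (Field s) s" "wf (s - Id)"
    using r s by (auto simp: wo_defs)
  have "refl_on (Field (ord_sum r s)) (ord_sum r s)"
    using R(1) S(1) by (auto simp: refl_on_def Field_ord_sum)
  moreover have "trans (ord_sum r s)"
  proof (rule transI)
    fix x y z assume "(x, y) \<in> ord_sum r s" "(y, z) \<in> ord_sum r s"
    then show "(x, z) \<in> ord_sum r s"
      using R(2) S(2) by (cases x; cases y; cases z) (auto dest: transD FieldI1 FieldI2)
  qed
  moreover have "antisym (ord_sum r s)"
  proof (rule antisymI)
    fix x y assume "(x, y) \<in> ord_sum r s" "(y, x) \<in> ord_sum r s"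
    then show "x = y"
      using R(3) S(3) by (cases x; cases y) (auto dest: antisymD)
  qed
  moreover have "total_on (Field (ord_sum r s)) (ord_sum r s)"
    using R(4) S(4) by (simp add: total_on_def Field_ord_sum ball_Un)
  moreover have "wf (ord_sum r s - Id)"
  proof (rule wfI_min)
    fix x :: "'a + 'b" and Q assume "x \<in> Q"
    show "\<exists>z\<in>Q. \<forall>y. (y, z) \<in> ord_sum r s - Id \<longrightarrow> y \<notin> Q"
    proof (cases "Inl -` Q = {}")
      case False
      then obtain z where "z \<in> Inl -` Q" "\<And>y. (y, z) \<in> r - Id \<Longrightarrow> y \<notin> Inl -` Q"
        using R(5) by (metis wfE_min ex_in_conv)
      then show ?thesis
        by (intro bexI[of _ "Inl z"]) (auto simp: ord_sum_def)
    next
      case True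
      with \<open>x \<in> Q\<close> have "Inr -` Q \<noteq> {}"
        by (cases x) auto
      then obtain z where "z \<in> Inr -` Q" "\<And>y. (y, z) \<in> s - Id \<Longrightarrow> y \<notin> Inr -` Q"
        using S(5) by (metis wfE_min ex_in_conv)
      then show ?thesis
        using True by (intro bexI[of _ "Inr z"]) (auto simp: ord_sum_def)
    qed
  qed
  ultimately show ?thesis
    by (auto simp: wo_defs FieldI1 FieldI2)
qed

lemma ord_sum_cong:
  assumes "r =o r'" and "s =o s'"
  shows "ord_sum r s =o ord_sum r' s'"
proof -
  from assms obtain f g where f: "iso r r' f" and g: "iso s s' g"
    and wo: "Well_order r" "Well_order r'" "Well_order s" "Well_order s'"
    unfolding ordIso_def by blast
  from f have f': "bij_betw f (Field r) (Field r')"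
      "\<And>x y. x \<in> Field r \<Longrightarrow> y \<in> Field r \<Longrightarrow> (x, y) \<in> r \<longleftrightarrow> (f x, f y) \<in> r'"
    by (auto simp: iso_iff2)
  from g have g': "bij_betw g (Field s) (Field s')"
      "\<And>x y. x \<in> Field s \<Longrightarrow> y \<in> Field s \<Longrightarrow> (x, y) \<in> s \<longleftrightarrow> (g x, g y) \<in> s'"
    by (auto simp: iso_iff2)
  have "bij_betw (map_sum f g) (Field (ord_sum r s)) (Field (ord_sum r' s'))"
  proof (rule bij_betw_imageI)
    show "inj_on (map_sum f g) (Field (ord_sum r s))"
    proof (rule inj_onI)
      fix x y assume "x \<in> Field (ord_sum r s)" "y \<in> Field (ord_sum r s)"
        "map_sum f g x = map_sum f g y"
      then show "x = y"
        using bij_betw_imp_inj_on[OF f'(1), THEN inj_onD] bij_betw_imp_inj_on[OF g'(1), THEN inj_onD]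
        by (cases x; cases y) (auto simp: Field_ord_sum)
    qed
    have "map_sum f g ` Field (ord_sum r s) = Inl ` f ` Field r \<union> Inr ` g ` Field s"
      by (simp add: Field_ord_sum image_Un image_image)
    also have "\<dots> = Field (ord_sum r' s')"
      using f'(1) g'(1) by (simp add: Field_ord_sum bij_betw_def)
    finally show "map_sum f g ` Field (ord_sum r s) = Field (ord_sum r' s')" .
  qed
  then have "iso (ord_sum r s) (ord_sum r' s') (map_sum f g)"
    using f'(2) g'(2) bij_betw_apply[OF f'(1)] bij_betw_apply[OF g'(1)]
    by (simp add: iso_iff2 Field_ord_sum ball_Un)
  with wo show ?thesis
    unfolding ordIso_def by (auto intro: Well_order_ord_sum)
qed

instantiation ordinal :: "{zero, plus}"
begin

lift_definition zero_ordinal :: ordinal is "{}"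
  by (simp add: ordIso_reflexive)

lift_definition plus_ordinal :: "ordinal \<Rightarrow> ordinal \<Rightarrow> ordinal"
  is "\<lambda>r s. dir_image (ord_sum r s) sum_encode"
proof -
  fix r r' s s' :: "nat rel"
  assume "r =o r'" "s =o s'"
  then have *: "ord_sum r s =o ord_sum r' s'"
    by (rule ord_sum_cong)
  then have "Well_order (ord_sum r s)" "Well_order (ord_sum r' s')"
    by (auto simp: ordIso_def)
  then have "ord_sum r s =o dir_image (ord_sum r s) sum_encode"
    "ord_sum r' s' =o dir_image (ord_sum r' s') sum_encode"
    by (simp_all add: dir_image_ordIso inj_sum_encode)
  with * show "dir_image (ord_sum r s) sum_encode =o dir_image (ord_sum r' s') sum_encode"
    by (meson ordIso_symmetric ordIso_transitive)
qed

instance ..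

end

text \<open>The ordinal sum \<open>\<omega> + \<dots> + \<omega>\<close> of \<open>m\<close> copies of \<open>\<omega>\<close>, often written \<open>\<omega> \<cdot> m\<close>.\<close>

primrec copies_of_omega :: "nat \<Rightarrow> ordinal" where
  "copies_of_omega 0 = 0"
| "copies_of_omega (Suc m) = copies_of_omega m + omega"

lemma zero_le_ordinal [simp]: "(0::ordinal) \<le> x"
  by transfer (auto simp: ordIso_refl_iff ordLeq_def embed_def)

unbundle no cardinal_syntax


section \<open>The ordinal number Ord\<close>

definition Fin_subsets :: "'a set \<Rightarrow> 'a set set" where
  "Fin_subsets L = {\<sigma>. \<sigma> \<subseteq> L \<and> finite \<sigma> \<and> \<sigma> \<noteq> {}}"

definition link :: "'a set \<Rightarrow> 'a set set \<Rightarrow> 'a \<Rightarrow> 'a set set" where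
  "link L M a = {\<tau> \<in> Fin_subsets L. \<tau> \<union> {a} \<in> M \<and> a \<notin> \<tau>}"

text \<open>\<open>Ord_le L M \<alpha>\<close> is the relation \<open>Ord M \<le> \<alpha>\<close>. The recursive call uses that
  \<open>Ord M' < \<alpha>\<close> means \<open>Ord M' \<le> \<beta>\<close> for some \<open>\<beta> < \<alpha>\<close>.\<close>

function Ord_le :: "'a set \<Rightarrow> 'a set set \<Rightarrow> ordinal \<Rightarrow> bool" where
  "Ord_le L M \<alpha> \<longleftrightarrow>
     (if \<alpha> = 0 then M = {} else \<forall>a\<in>L. \<exists>\<beta>\<in>{..<\<alpha>}. Ord_le L (link L M a) \<beta>)"
  by pat_completeness auto
termination
  by (relation "inv_image {(\<beta>, \<alpha>). \<beta> < \<alpha>} (\<lambda>(L, M, \<alpha>). \<alpha>)") (auto intro: wf)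

declare Ord_le.simps [simp del]

text \<open>For a countable set \<open>L\<close>, \<open>Ord M\<close> is a countable ordinal or \<open>\<infinity>\<close> (written \<open>Pinf\<close>), so
  the countable ordinals suffice as values; \<open>Minf\<close> is never attained.\<close>

definition Ord :: "'a::countable set \<Rightarrow> 'a set set \<Rightarrow> ordinal extended" where
  "Ord L M = (if \<exists>\<alpha>. Ord_le L M \<alpha> then Fin (LEAST \<alpha>. Ord_le L M \<alpha>) else Pinf)"

lemma Ord_le_mono:
  assumes "Ord_le L M \<alpha>" and "\<alpha> \<le> \<beta>"
  shows "Ord_le L M \<beta>"
proof (cases "\<alpha> = 0")
  case True
  with assms(1) have "M = {}"
    by (simp add: Ord_le.simps)
  then have "link L M a = {}" for a
    by (simp add: link_def)
  moreover have "Ord_le L {} 0"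
    by (simp add: Ord_le.simps)
  moreover have "0 < \<beta>" if "\<beta> \<noteq> 0"
    using that by (simp add: order_less_le)
  ultimately show ?thesis
    using \<open>M = {}\<close> by (subst Ord_le.simps) auto
next
  case False
  with assms(2) have "\<beta> \<noteq> 0"
    by (metis zero_le_ordinal order_antisym)
  have step: "\<exists>\<gamma>\<in>{..<\<beta>}. Ord_le L (link L M a) \<gamma>" if "a \<in> L" for a
  proof -
    from assms(1) False that obtain \<gamma> where "\<gamma> < \<alpha>" "Ord_le L (link L M a) \<gamma>"
      by (subst (asm) Ord_le.simps) auto
    with assms(2) show ?thesis
      by (auto intro: less_le_trans)
  qed
  show ?thesis
    by (subst Ord_le.simps) (use \<open>\<beta> \<noteq> 0\<close> step in auto)
qed

lemma Ord_le_iff: "Ord L M \<le> Fin \<alpha> \<longleftrightarrow> Ord_le L M \<alpha>"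
proof
  assume "Ord L M \<le> Fin \<alpha>"
  then have "\<exists>\<beta>. Ord_le L M \<beta>" "(LEAST \<beta>. Ord_le L M \<beta>) \<le> \<alpha>"
    by (auto simp: Ord_def split: if_splits)
  then show "Ord_le L M \<alpha>"
    using Ord_le_mono LeastI_ex[of "Ord_le L M"] by blast
next
  assume "Ord_le L M \<alpha>"
  then show "Ord L M \<le> Fin \<alpha>"
    by (auto simp: Ord_def intro: Least_le)
qed


section \<open>Uniformly bounded families in \<open>\<infinity>\<close>-pseudometric spaces\<close>

definition inf_pseudometric :: "'a set \<Rightarrow> ('a \<Rightarrow> 'a \<Rightarrow> ennreal) \<Rightarrow> bool" where
  "inf_pseudometric X d \<longleftrightarrow>
     (\<forall>x\<in>X. d x x = 0) \<and>
     (\<forall>x\<in>X. \<forall>y\<in>X. d x y = d y x) \<and>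
     (\<forall>x\<in>X. \<forall>y\<in>X. \<forall>z\<in>X. d x z \<le> d x y + d y z)"

definition pdiam :: "('a \<Rightarrow> 'a \<Rightarrow> ennreal) \<Rightarrow> 'a set \<Rightarrow> ennreal" where
  "pdiam d U = (SUP x\<in>U. SUP y\<in>U. d x y)"

definition mesh :: "('a \<Rightarrow> 'a \<Rightarrow> ennreal) \<Rightarrow> 'a set set \<Rightarrow> ennreal" where
  "mesh d \<U> = (SUP U\<in>\<U>. pdiam d U)"

definition uniformly_bounded :: "('a \<Rightarrow> 'a \<Rightarrow> ennreal) \<Rightarrow> 'a set set \<Rightarrow> bool" where
  "uniformly_bounded d \<U> \<longleftrightarrow> mesh d \<U> < top"

definition set_pdist :: "('a \<Rightarrow> 'a \<Rightarrow> ennreal) \<Rightarrow> 'a set \<Rightarrow> 'a set \<Rightarrow> ennreal" where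
  "set_pdist d A B = (INF a\<in>A. INF b\<in>B. d a b)"

definition r_disjoint :: "('a \<Rightarrow> 'a \<Rightarrow> ennreal) \<Rightarrow> real \<Rightarrow> 'a set set \<Rightarrow> bool" where
  "r_disjoint d r \<U> \<longleftrightarrow> (\<forall>A\<in>\<U>. \<forall>B\<in>\<U>. A \<noteq> B \<longrightarrow> ennreal r \<le> set_pdist d A B)"


section \<open>Scale-\<open>r\<close>-dimension\<close>

definition pball :: "'a set \<Rightarrow> ('a \<Rightarrow> 'a \<Rightarrow> ennreal) \<Rightarrow> 'a \<Rightarrow> real \<Rightarrow> 'a set" where
  "pball X d x r = {z\<in>X. d x z < ennreal r}"

definition scale_component :: "'a set \<Rightarrow> ('a \<Rightarrow> 'a \<Rightarrow> ennreal) \<Rightarrow> real \<Rightarrow> 'a \<Rightarrow> 'a set" where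
  "scale_component X d r x =
     {y. \<exists>(n::nat) s. s 0 = y \<and> s n = x \<and> (\<forall>i\<le>n. s i \<in> X) \<and>
           (\<forall>i<n. pball X d (s i) r \<inter> pball X d (s (Suc i)) r \<noteq> {})}"

definition scale_dim_0 :: "'a set \<Rightarrow> ('a \<Rightarrow> 'a \<Rightarrow> ennreal) \<Rightarrow> real \<Rightarrow> bool" where
  "scale_dim_0 X d r \<longleftrightarrow> uniformly_bounded d (scale_component X d r ` X)"

definition scale_dim_le :: "'a set \<Rightarrow> ('a \<Rightarrow> 'a \<Rightarrow> ennreal) \<Rightarrow> real \<Rightarrow> nat \<Rightarrow> bool" where
  "scale_dim_le X d r n \<longleftrightarrow>
     (\<exists>Y::nat \<Rightarrow> 'a set. X = (\<Union>i\<le>n. Y i) \<and> (\<forall>i\<le>n. scale_dim_0 (Y i) d r))"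


section \<open>Integral APD profiles\<close>

text \<open>\<open>integral_APD_profile X d k a \<alpha>\<close>: the array \<open>(a, \<alpha> 1, \<dots>, \<alpha> k)\<close>, whose first entry is the
  constant function with value \<open>a\<close>, is an integral APD profile of \<open>X\<close>. The values \<open>\<alpha> i\<close> for
  \<open>i\<close> outside \<open>{1..k}\<close>, and \<open>\<alpha> i 0\<close>, are irrelevant.\<close>

definition integral_APD_profile ::
    "'a set \<Rightarrow> ('a \<Rightarrow> 'a \<Rightarrow> ennreal) \<Rightarrow> nat \<Rightarrow> nat \<Rightarrow> (nat \<Rightarrow> nat \<Rightarrow> nat) \<Rightarrow> bool" where
  "integral_APD_profile X d k a \<alpha> \<longleftrightarrow>
     0 < a \<and>
     (\<forall>i\<in>{1..k}. (\<forall>t>0. 0 < \<alpha> i t) \<and> mono_on {0<..} (\<alpha> i)) \<and>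
     (\<forall>r::nat \<Rightarrow> nat. (\<forall>i\<le>k. 0 < r i) \<and> (\<forall>i<k. r i \<le> r (Suc i)) \<longrightarrow>
        (\<exists>Y::nat \<Rightarrow> 'a set. X = (\<Union>i\<le>k. Y i) \<and>
           scale_dim_le (Y 0) d (real (r 0)) (a - 1) \<and>
           (\<forall>i\<in>{1..k}. scale_dim_le (Y i) d (real (r i)) (\<alpha> i (r (i - 1)) - 1))))"


section \<open>Transfinite asymptotic dimension\<close>

text \<open>The ordinal does not change if, in the definition of \<open>non_covering\<close>, one requires each
  \<open>Y i\<close> to have scale-\<open>i\<close>-dimension \<open>0\<close> instead. The set \<open>{0<..}\<close> is the set of positive
  integers.\<close>

definition non_covering :: "'a set \<Rightarrow> ('a \<Rightarrow> 'a \<Rightarrow> ennreal) \<Rightarrow> nat set set" where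
  "non_covering X d =
     {\<sigma> \<in> Fin_subsets {0<..}.
        \<not> (\<exists>Y::nat \<Rightarrow> 'a set. X = (\<Union>i\<in>\<sigma>. Y i) \<and>
             (\<forall>i\<in>\<sigma>. \<exists>\<U>. Y i = \<Union>\<U> \<and> r_disjoint d (real i) \<U> \<and> uniformly_bounded d \<U>))}"

definition trasdim :: "'a set \<Rightarrow> ('a \<Rightarrow> 'a \<Rightarrow> ennreal) \<Rightarrow> ordinal extended" where
  "trasdim X d = Ord {0<..} (non_covering X d)"

end

theory Submission
  imports Defs
begin

text \<open>Think of \<open>Ord M \<le> m \<cdot> \<omega> + n\<close> as a game: an opponent names the elements
  \<open>a\<^sub>1, a\<^sub>2, \<dots>\<close> of a set one by one, each move replaces \<open>M\<close> by a link, and a counter,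
  which is an ordinal starting at \<open>m \<cdot> \<omega> + n\<close>, has to go down at every move. At a successor the
  counter drops by one. At a limit \<open>(j + 1) \<cdot> \<omega>\<close> it drops to \<open>j \<cdot> \<omega> + N\<close>, where \<open>N\<close> may depend
  on everything named so far. So the opponent names a first block of \<open>n + 1\<close> elements, with
  maximum \<open>r\<^sub>0\<close> say; now \<open>N = \<alpha>\<^sub>1(r\<^sub>0) - 1\<close> is chosen, and the opponent names a second
  block of \<open>\<alpha>\<^sub>1(r\<^sub>0)\<close> elements; if \<open>r\<^sub>1\<close> bounds everything named up to then, the third block
  has \<open>\<alpha>\<^sub>2(r\<^sub>1)\<close> elements, and so on. If \<open>M\<close> contains no set that splits into blocks of these
  sizes (a \<open>large\<close> set), then nothing is left of \<open>M\<close> when the counter reaches \<open>0\<close>, so that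
  \<open>Ord M \<le> m \<cdot> \<omega> + n\<close>. This is \<open>Ord_le_if_no_large\<close>.

  The block sizes are those for which an integral APD profile provides covers. Apply the profile
  to the bounds \<open>(r\<^sub>0, \<dots>, r\<^sub>m)\<close> of the blocks of a large set: the piece \<open>X\<^sub>i\<close> is the union of at
  most as many sets of scale-\<open>r\<^sub>i\<close>-dimension \<open>0\<close> as the \<open>i\<close>-th block has elements, so these
  sets can be indexed by the block. The scale components of such a set are
  \<open>r\<^sub>i\<close>-disjoint, hence \<open>b\<close>-disjoint for each \<open>b\<close> in the block, because \<open>b \<le> r\<^sub>i\<close>. So a
  large set indexes a cover of \<open>X\<close> and is not in \<open>non_covering X d\<close>
  (\<open>large_not_non_covering\<close>).\<close>


section \<open>Strict monotonicity of ordinal addition\<close>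

unbundle cardinal_syntax

text \<open>A smaller well-order is isomorphic to the proper initial segment below some \<open>a\<close>, and
  putting \<open>r\<close> in front turns it into the initial segment below \<open>Inr a\<close>.\<close>

lemma ord_sum_strict_mono:
  assumes r: "Well_order r" and "s <o s'"
  shows "ord_sum r s <o ord_sum r s'"
proof -
  from assms have s': "Well_order s'"
    by (auto simp: ordLess_def)
  obtain a where a: "a \<in> Field s'" and iso: "s =o Restr s' (underS s' a)"
    using assms(2) s' ordLess_iff_ordIso_Restr[of s' s] by (auto simp: ordLess_def)
  have wo: "Well_order (ord_sum r s')"
    using r s' by (rule Well_order_ord_sum)
  have "Refl s'"
    using s' by (simp add: order_on_defs)
  then have "Field (Restr s' (underS s' a)) = underS s' a"
    by (rule Refl_Field_Restr2) (rule Order_Relation.underS_Field)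
  then have segment: "ord_sum r (Restr s' (underS s' a)) =
      Restr (ord_sum r s') (underS (ord_sum r s') (Inr a))"
    using a by (auto simp: ord_sum_def underS_def Field_iff)
  have "ord_sum r s =o ord_sum r (Restr s' (underS s' a))"
    using r iso by (intro ord_sum_cong ordIso_reflexive)
  moreover have "Inr a \<in> Field (ord_sum r s')"
    using a by (simp add: Field_ord_sum)
  moreover have "Well_order (ord_sum r s)"
    using r assms(2) by (auto simp: ordLess_def intro: Well_order_ord_sum)
  ultimately show ?thesis
    unfolding segment using ordLess_iff_ordIso_Restr[OF wo] by blast
qed

lemma ord_sum_empty: "Well_order r \<Longrightarrow> r =o ord_sum r {}"
proof -
  assume "Well_order r"
  moreover have "ord_sum r {} = dir_image r Inl"
    by (auto simp: ord_sum_def dir_image_def)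
  ultimately show ?thesis
    by (metis dir_image_ordIso inj_Inl)
qed

lemma ord_sum_encode:
  assumes "Well_order r" "Well_order s"
  shows "ord_sum r s =o dir_image (ord_sum r s) sum_encode"
  using assms by (intro dir_image_ordIso Well_order_ord_sum inj_sum_encode)

lemma ordinal_add_strict_mono: "\<beta> < \<gamma> \<Longrightarrow> \<alpha> + \<beta> < \<alpha> + (\<gamma> :: ordinal)"
proof (transfer, unfold ordIso_refl_iff)
  fix r s s' :: "nat rel"
  assume wo: "Well_order r" "Well_order s" "Well_order s'" and "s <o s'"
  then have "ord_sum r s <o ord_sum r s'"
    by (intro ord_sum_strict_mono)
  then show "dir_image (ord_sum r s) sum_encode <o dir_image (ord_sum r s') sum_encode"
    using wo by (meson ord_sum_encode ordIso_ordLess_cong)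
qed

lemma ordinal_add_zero: "\<alpha> + 0 = (\<alpha> :: ordinal)"
proof (transfer, unfold ordIso_refl_iff)
  fix r :: "nat rel"
  assume "Well_order r"
  then show "dir_image (ord_sum r {}) sum_encode =o r"
    using ord_sum_encode[of r "{} :: nat rel"] ord_sum_empty[of r]
    by (metis ordIso_symmetric ordIso_transitive well_order_on_empty Field_empty)
qed

lemma ord_of_nat_0: "ord_of_nat 0 = 0"
  by transfer (simp add: ordIso_reflexive)

lemma ord_of_nat_less_omega: "ord_of_nat k < omega"
proof transfer
  fix k
  show "natLeq_on k <o natLeq"
    using underS_Restr_ordLess[OF natLeq_Well_order, of k]
    by (simp add: natLeq_underS_less Restr_natLeq Field_natLeq)
qed

lemma ord_of_nat_less_Suc: "ord_of_nat k < ord_of_nat (Suc k)"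
proof transfer
  fix k
  have "Restr (natLeq_on (Suc k)) (underS (natLeq_on (Suc k)) k) = natLeq_on k"
    by (auto simp: underS_def)
  then show "natLeq_on k <o natLeq_on (Suc k)"
    using underS_Restr_ordLess[OF natLeq_on_Well_order, of "Suc k" k]
    by (auto simp: Field_natLeq_on)
qed

unbundle no cardinal_syntax


section \<open>Bounding Ord by large sets\<close>

lemma Ord_le_empty: "Ord_le L {} \<alpha>"
  by (rule Ord_le_mono[of _ _ 0]) (simp_all add: Ord_le.simps)

text \<open>The case \<open>\<alpha> = 0\<close> of the definition of \<open>Ord_le\<close> cannot occur here: any \<open>a \<in> L\<close>
  provides an ordinal below \<open>\<alpha>\<close>.\<close>

lemma Ord_leI:
  assumes "L \<noteq> {}" and "\<And>a. a \<in> L \<Longrightarrow> \<exists>\<beta><\<alpha>. Ord_le L (link L M a) \<beta>"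
  shows "Ord_le L M \<alpha>"
proof -
  have "\<alpha> \<noteq> 0"
    using assms by (metis ex_in_conv leD zero_le_ordinal)
  with assms(2) show ?thesis
    by (subst Ord_le.simps) auto
qed

lemma link_subset_Fin: "link L M a \<subseteq> Fin_subsets L"
  by (auto simp: link_def)

text \<open>A set is large for \<open>(f\<^sub>1, \<dots>, f\<^sub>l)\<close>, \<open>k\<close> and \<open>r\<close> if it contains pairwise disjoint blocks
  \<open>B\<^sub>0, \<dots>, B\<^sub>l\<close> such that \<open>B\<^sub>0\<close> has \<open>k\<close> elements and the size of \<open>B\<^sub>i\<close> is \<open>f\<^sub>i s\<close>, where \<open>s\<close> is
  an upper bound, at least \<open>r\<close>, of the preceding blocks. The parameter \<open>r\<close> stands for the
  elements named earlier in the game; keeping it apart from the set lets a link of a family be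
  treated like the family itself. The bound \<open>s\<close> is arbitrary, not the maximum, so that it
  need not change when an element is added to the first block.\<close>

fun large :: "(nat \<Rightarrow> nat) list \<Rightarrow> nat \<Rightarrow> nat \<Rightarrow> nat set \<Rightarrow> bool" where
  "large [] k r \<sigma> \<longleftrightarrow> k \<le> card \<sigma>"
| "large (f # fs) k r \<sigma> \<longleftrightarrow>
     (\<exists>B s. B \<subseteq> \<sigma> \<and> card B = k \<and> B \<subseteq> {..s} \<and> r \<le> s \<and> large fs (f s) s (\<sigma> - B))"

text \<open>The new element joins the first block, whose bound \<open>s\<close> remains valid as \<open>a \<le> s\<close>.\<close>

lemma large_insert:
  assumes "large fs k (max r a) \<tau>" and "a \<notin> \<tau>" and "finite \<tau>"
  shows "large fs (Suc k) r (\<tau> \<union> {a})"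
proof (cases fs)
  case Nil
  with assms show ?thesis by simp
next
  case (Cons f fs')
  with assms obtain B s where B: "B \<subseteq> \<tau>" "card B = k" "B \<subseteq> {..s}" "max r a \<le> s"
    "large fs' (f s) s (\<tau> - B)"
    by auto
  have "\<tau> \<union> {a} - insert a B = \<tau> - B"
    using assms(2) by auto
  moreover have "card (insert a B) = Suc k"
    using B assms by (subst card_insert_disjoint) (auto dest: finite_subset)
  ultimately show ?thesis
    using B Cons by (auto intro!: exI[of _ "insert a B"] exI[of _ s])
qed

text \<open>Induction on the number of blocks still to be completed and, inside, on the number of elements
  that the current block lacks. A set in the link of \<open>a\<close> that is large for the remaining task
  would, together with \<open>a\<close>, be a large set in \<open>M\<close>. If \<open>a\<close> completes the
  block, the size \<open>f s\<close> of the next one becomes known, with \<open>s = max r a\<close>, and this is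
  where the ordinal drops below a limit. Links do not contain the empty set, so the block sizes are
  \<open>k + 1\<close> when the ordinal ends with \<open>k\<close>; for this the values of the functions
  must be positive.\<close>

lemma Ord_le_if_no_large:
  assumes "M \<subseteq> Fin_subsets {0<..}"
    and "\<And>\<sigma>. \<sigma> \<in> M \<Longrightarrow> \<not> large fs (Suc k) r \<sigma>"
    and "\<And>f s. f \<in> set fs \<Longrightarrow> 0 < s \<Longrightarrow> 0 < f s"
  shows "Ord_le {0<..} M (copies_of_omega (length fs) + ord_of_nat k)"
  using assms
proof (induction fs arbitrary: M k r)
  case Nil
  then show ?case
  proof (induction k arbitrary: M)
    case 0
    have "M = {}"
      using 0 by (force simp: Fin_subsets_def card_gt_0_iff Suc_le_eq)
    then show ?case by (simp add: Ord_le_empty)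
  next
    case (Suc k)
    show ?case
    proof (rule Ord_leI)
      fix a :: nat assume "a \<in> {0<..}"
      have "\<not> large [] (Suc k) r \<tau>" if "\<tau> \<in> link {0<..} M a" for \<tau>
        using that Suc.prems(2)[of "\<tau> \<union> {a}"]
        by (auto simp: link_def Fin_subsets_def)
      then have "Ord_le {0<..} (link {0<..} M a) (copies_of_omega (length []) + ord_of_nat k)"
        using Suc.IH[OF link_subset_Fin] by force
      then show "\<exists>\<beta><copies_of_omega (length []) + ord_of_nat (Suc k).
          Ord_le {0<..} (link {0<..} M a) \<beta>"
        using ordinal_add_strict_mono ord_of_nat_less_Suc by blast
    qed simp
  qed
next
  case (Cons f fs)
  note IH = Cons.IH and pos = Cons.prems(3)
  from Cons.prems(1,2) show ?case
  proof (induction k arbitrary: M r)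
    case 0
    show ?case
    proof (rule Ord_leI)
      fix a :: nat assume a: "a \<in> {0<..}"
      define s where "s = max r a"
      have Suc_f: "Suc (f s - 1) = f s"
        using pos[of f s] a by (simp add: s_def)
      have "\<not> large fs (Suc (f s - 1)) s \<tau>" if "\<tau> \<in> link {0<..} M a" for \<tau>
      proof
        assume "large fs (Suc (f s - 1)) s \<tau>"
        \<comment> \<open>\<open>{a}\<close> alone is the current block.\<close>
        moreover have "\<tau> \<union> {a} - {a} = \<tau>" and M: "\<tau> \<union> {a} \<in> M"
          using that by (auto simp: link_def)
        ultimately have "large (f # fs) (Suc 0) r (\<tau> \<union> {a})"
          unfolding Suc_f large.simps by (intro exI[of _ "{a}"] exI[of _ s]) (simp add: s_def)
        with 0(2)[OF M] show False by contradiction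
      qed
      then have "Ord_le {0<..} (link {0<..} M a) (copies_of_omega (length fs) + ord_of_nat (f s - 1))"
        using pos by (intro IH[of _ "f s - 1" s] link_subset_Fin) simp_all
      moreover have "copies_of_omega (length fs) + ord_of_nat (f s - 1)
          < copies_of_omega (length (f # fs)) + ord_of_nat 0"
        by (simp add: ord_of_nat_0 ordinal_add_zero ordinal_add_strict_mono ord_of_nat_less_omega)
      ultimately show "\<exists>\<beta><copies_of_omega (length (f # fs)) + ord_of_nat 0.
          Ord_le {0<..} (link {0<..} M a) \<beta>"
        by blast
    qed simp
  next
    case (Suc k)
    show ?case
    proof (rule Ord_leI)
      fix a :: nat assume "a \<in> {0<..}"
      have "\<not> large (f # fs) (Suc k) (max r a) \<tau>" if "\<tau> \<in> link {0<..} M a" for \<tau>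
      proof
        assume "large (f # fs) (Suc k) (max r a) \<tau>"
        moreover have "a \<notin> \<tau>" "finite \<tau>"
          using that by (auto simp: link_def Fin_subsets_def)
        ultimately have "large (f # fs) (Suc (Suc k)) r (\<tau> \<union> {a})"
          by (rule large_insert)
        moreover have M: "\<tau> \<union> {a} \<in> M"
          using that by (simp add: link_def)
        ultimately show False using Suc.prems(2)[OF M] by blast
      qed
      then have "Ord_le {0<..} (link {0<..} M a) (copies_of_omega (length (f # fs)) + ord_of_nat k)"
        by (rule Suc.IH[OF link_subset_Fin])
      then show "\<exists>\<beta><copies_of_omega (length (f # fs)) + ord_of_nat (Suc k).
          Ord_le {0<..} (link {0<..} M a) \<beta>"
        using ordinal_add_strict_mono ord_of_nat_less_Suc by blast
    qed simp
  qed
qed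


section \<open>Large sets index covers\<close>

text \<open>The recursion in \<open>large\<close> is unrolled, because a profile is applied to the bounds of all
  blocks at the same time.\<close>

lemma large_blocks:
  assumes "large fs k r \<sigma>" and "finite \<sigma>"
  obtains B \<rho> where "\<And>i. i \<le> length fs \<Longrightarrow> B i \<subseteq> \<sigma> \<inter> {..\<rho> i}"
    and "disjoint_family_on B {..length fs}"
    and "k \<le> card (B 0)" and "\<And>i. i < length fs \<Longrightarrow> (fs ! i) (\<rho> i) \<le> card (B (Suc i))"
    and "r \<le> \<rho> 0" and "\<And>i. i < length fs \<Longrightarrow> \<rho> i \<le> \<rho> (Suc i)"
  using assms
proof (induction fs arbitrary: k r \<sigma> thesis)
  case Nil
  show ?case
    using Nil.prems(2,3)
    by (intro Nil.prems(1)[of "\<lambda>_. \<sigma>" "\<lambda>_. Max (insert r \<sigma>)"]) (auto simp: disjoint_family_on_def)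
next
  case (Cons f fs)
  from Cons.prems(2) obtain B0 s where B0: "B0 \<subseteq> \<sigma>" "card B0 = k" "B0 \<subseteq> {..s}" "r \<le> s"
    and large: "large fs (f s) s (\<sigma> - B0)"
    by auto
  have fin: "finite (\<sigma> - B0)" using Cons.prems(3) by simp
  obtain B \<rho> where B: "\<And>i. i \<le> length fs \<Longrightarrow> B i \<subseteq> (\<sigma> - B0) \<inter> {..\<rho> i}"
    "disjoint_family_on B {..length fs}"
    "f s \<le> card (B 0)" "\<And>i. i < length fs \<Longrightarrow> (fs ! i) (\<rho> i) \<le> card (B (Suc i))"
    "s \<le> \<rho> 0" "\<And>i. i < length fs \<Longrightarrow> \<rho> i \<le> \<rho> (Suc i)"
    by (rule Cons.IH[OF that large fin])
  show ?case
  proof (rule Cons.prems(1)[of "case_nat B0 B" "case_nat s \<rho>"])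
    show "disjoint_family_on (case_nat B0 B) {..length (f # fs)}"
      unfolding disjoint_family_on_def
    proof (intro ballI impI)
      fix i j assume ij: "i \<in> {..length (f # fs)}" "j \<in> {..length (f # fs)}" "i \<noteq> j"
      show "case_nat B0 B i \<inter> case_nat B0 B j = {}"
      proof (cases i)
        case 0
        with ij show ?thesis
          using B(1) by (cases j) fastforce+
      next
        case (Suc i')
        show ?thesis
        proof (cases j)
          case 0
          with Suc ij show ?thesis
            using B(1)[of i'] by auto
        next
          case (Suc j')
          with ij \<open>i = Suc i'\<close> show ?thesis
            using disjoint_family_onD[OF B(2), of i' j'] by simp
        qed
      qed
    qed
    show "case_nat B0 B i \<subseteq> \<sigma> \<inter> {..case_nat s \<rho> i}" if "i \<le> length (f # fs)" for i
      using that B(1) B0 by (cases i) auto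
    show "((f # fs) ! i) (case_nat s \<rho> i) \<le> card (case_nat B0 B (Suc i))"
      if "i < length (f # fs)" for i
      using that B by (cases i) auto
    show "case_nat s \<rho> i \<le> case_nat s \<rho> (Suc i)" if "i < length (f # fs)" for i
      using that B by (cases i) auto
  qed (use B0 in auto)
qed

text \<open>This makes the symmetry and transitivity of chains available from the theory of
  relations.\<close>

lemma scale_component_eq:
  assumes "x \<in> Y"
  shows "scale_component Y d r x =
    {y. (y, x) \<in> {(u, v). u \<in> Y \<and> v \<in> Y \<and> pball Y d u r \<inter> pball Y d v r \<noteq> {}}\<^sup>*}"
    (is "_ = {y. (y, x) \<in> ?R\<^sup>*}")
proof (intro set_eqI)
  fix y
  have "y \<in> scale_component Y d r x \<longleftrightarrow>
      (\<exists>n s. s 0 = y \<and> s n = x \<and> (\<forall>i<n. (s i, s (Suc i)) \<in> ?R))" (is "_ \<longleftrightarrow> ?rhs")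
  proof
    assume ?rhs
    then obtain n s where s: "s 0 = y" "s n = x" "\<forall>i<n. (s i, s (Suc i)) \<in> ?R" by blast
    moreover have "s i \<in> Y" if "i \<le> n" for i
      using that s assms by (cases "i = n") auto
    ultimately show "y \<in> scale_component Y d r x"
      unfolding scale_component_def by blast
  next
    assume "y \<in> scale_component Y d r x"
    then obtain n s where "s 0 = y" "s n = x" "\<forall>i\<le>n. s i \<in> Y"
      "\<forall>i<n. pball Y d (s i) r \<inter> pball Y d (s (Suc i)) r \<noteq> {}"
      unfolding scale_component_def by blast
    then have "s 0 = y \<and> s n = x \<and> (\<forall>i<n. (s i, s (Suc i)) \<in> ?R)"
      by simp
    then show ?rhs by blast
  qed
  then show "y \<in> scale_component Y d r x \<longleftrightarrow> y \<in> {y. (y, x) \<in> ?R\<^sup>*}"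
    by (auto simp: rtrancl_power relpow_fun_conv)
qed

definition splits_at_scale :: "('a \<Rightarrow> 'a \<Rightarrow> ennreal) \<Rightarrow> real \<Rightarrow> 'a set \<Rightarrow> bool" where
  "splits_at_scale d r Y \<longleftrightarrow>
     (\<exists>\<U>. Y = \<Union>\<U> \<and> r_disjoint d r \<U> \<and> uniformly_bounded d \<U>)"

lemma splits_at_scale_empty: "splits_at_scale d r {}"
  unfolding splits_at_scale_def
  by (intro exI[of _ "{}"]) (auto simp: r_disjoint_def uniformly_bounded_def mesh_def bot_ennreal)

lemma splits_at_scale_mono:
  assumes "splits_at_scale d s Y" and "r \<le> s"
  shows "splits_at_scale d r Y"
proof -
  have "r_disjoint d r \<U>" if "r_disjoint d s \<U>" for \<U>
    using that order_trans[OF ennreal_leI[OF assms(2)]] by (simp add: r_disjoint_def)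
  with assms(1) show ?thesis
    unfolding splits_at_scale_def by blast
qed

text \<open>The scale components are the required family. If \<open>d a b < r\<close> for two points of \<open>Y\<close>, then
  \<open>b\<close> lies in the balls around both of them, so \<open>a\<close> and \<open>b\<close> are in the same
  component.\<close>

lemma scale_dim_0_imp_splits:
  assumes zero: "\<And>x. x \<in> Y \<Longrightarrow> d x x = 0" and "0 < r" and dim: "scale_dim_0 Y d r"
  shows "splits_at_scale d r Y"
proof -
  define R where "R = {(u, v). u \<in> Y \<and> v \<in> Y \<and> pball Y d u r \<inter> pball Y d v r \<noteq> {}}"
  have comp: "scale_component Y d r x = {y. (y, x) \<in> R\<^sup>*}" if "x \<in> Y" for x
    using that by (simp add: scale_component_eq R_def)
  have "sym (R\<^sup>*)"
    by (rule sym_rtrancl) (auto simp: R_def sym_def)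
  have sub: "y \<in> Y" if "(y, x) \<in> R\<^sup>*" "x \<in> Y" for x y
    using that by (cases rule: converse_rtranclE) (auto simp: R_def)
  have close: "{z. (z, x) \<in> R\<^sup>*} = {z. (z, y) \<in> R\<^sup>*}"
    if "x \<in> Y" "y \<in> Y" "(a, x) \<in> R\<^sup>*" "(b, y) \<in> R\<^sup>*" "d a b < ennreal r" for x y a b
  proof -
    have "a \<in> Y" "b \<in> Y"
      using that sub by blast+
    then have "b \<in> pball Y d a r \<inter> pball Y d b r"
      using zero[of b] \<open>0 < r\<close> that(5) by (simp add: pball_def)
    with \<open>a \<in> Y\<close> \<open>b \<in> Y\<close> have "(a, b) \<in> R"
      by (auto simp: R_def)
    with that have "(x, y) \<in> R\<^sup>*" "(y, x) \<in> R\<^sup>*"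
      using \<open>sym (R\<^sup>*)\<close> by (meson rtrancl_trans r_into_rtrancl symD)+
    then show ?thesis
      by (auto intro: rtrancl_trans)
  qed
  have "r_disjoint d r (scale_component Y d r ` Y)"
    unfolding r_disjoint_def set_pdist_def
  proof (intro ballI impI INF_greatest)
    fix A B a b
    assume "A \<in> scale_component Y d r ` Y" "B \<in> scale_component Y d r ` Y"
      and *: "A \<noteq> B" "a \<in> A" "b \<in> B"
    then obtain x y where "x \<in> Y" "y \<in> Y" and A: "A = {z. (z, x) \<in> R\<^sup>*}" and B: "B = {z. (z, y) \<in> R\<^sup>*}"
      using comp by auto
    then have "\<not> d a b < ennreal r"
      using close[of x y a b] * by auto
    then show "ennreal r \<le> d a b" by simp
  qed
  moreover have "Y = \<Union> (scale_component Y d r ` Y)"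
    using comp sub by fastforce
  ultimately show ?thesis
    using dim unfolding splits_at_scale_def scale_dim_0_def by blast
qed

text \<open>The \<open>k\<close> sets of dimension \<open>0\<close> are distributed over \<open>B\<close>; surplus indices get the empty
  set.\<close>

lemma scale_dim_le_imp_cover:
  assumes zero: "\<And>x. x \<in> Z \<Longrightarrow> d x x = 0" and "0 < r" and dim: "scale_dim_le Z d r (k - 1)"
    and "0 < k" "k \<le> card B"
  shows "\<exists>W. Z = (\<Union>b\<in>B. W b) \<and> (\<forall>b\<in>B. splits_at_scale d r (W b))"
proof -
  from dim obtain Y where Y: "Z = (\<Union>i\<le>k - 1. Y i)" "\<And>i. i \<le> k - 1 \<Longrightarrow> scale_dim_0 (Y i) d r"
    unfolding scale_dim_le_def by blast
  have fin: "finite B"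
    using assms(4,5) by (metis card.infinite not_less)
  then obtain h where h: "bij_betw h B {0..<card B}"
    using ex_bij_betw_finite_nat by blast
  define W where "W b = (if h b \<le> k - 1 then Y (h b) else {})" for b
  have "splits_at_scale d r (Y i)" if "i \<le> k - 1" for i
    using that Y zero \<open>0 < r\<close> by (intro scale_dim_0_imp_splits) auto
  then have "splits_at_scale d r (W b)" for b
    by (simp add: W_def splits_at_scale_empty)
  moreover have "\<exists>b\<in>B. h b = i" if "i \<le> k - 1" for i
  proof -
    have "i \<in> h ` B"
      using h that assms(4,5) by (simp add: bij_betw_def)
    then show ?thesis by blast
  qed
  then have "Z = (\<Union>b\<in>B. W b)"
    unfolding Y(1) by (fastforce simp: W_def split: if_splits)
  ultimately show ?thesis by blast
qed

text \<open>The scales are the bounds \<open>\<rho> i\<close> of the blocks: the size of a block was prescribed from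
  the bound of the block before it, exactly as the dimension of the \<open>i\<close>-th piece of the profile
  depends on the scale of the piece before it.\<close>

lemma large_not_non_covering:
  assumes zero: "\<And>x. x \<in> X \<Longrightarrow> d x x = 0"
    and profile: "integral_APD_profile X d m (n + 1) \<alpha>"
    and large: "large (map \<alpha> [1..<Suc m]) (n + 1) 1 \<sigma>"
  shows "\<sigma> \<notin> non_covering X d"
proof
  assume \<sigma>: "\<sigma> \<in> non_covering X d"
  then have "finite \<sigma>"
    by (auto simp: non_covering_def Fin_subsets_def)
  obtain B \<rho> where blocks:
    "\<And>i. i \<le> length (map \<alpha> [1..<Suc m]) \<Longrightarrow> B i \<subseteq> \<sigma> \<inter> {..\<rho> i}"
    "disjoint_family_on B {..length (map \<alpha> [1..<Suc m])}" "n + 1 \<le> card (B 0)"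
    "\<And>i. i < length (map \<alpha> [1..<Suc m]) \<Longrightarrow>
      (map \<alpha> [1..<Suc m] ! i) (\<rho> i) \<le> card (B (Suc i))"
    "1 \<le> \<rho> 0" "\<And>i. i < length (map \<alpha> [1..<Suc m]) \<Longrightarrow> \<rho> i \<le> \<rho> (Suc i)"
    by (rule large_blocks[OF large \<open>finite \<sigma>\<close>]) (rule that)
  have len: "length (map \<alpha> [1..<Suc m]) = m"
    by simp
  have B: "B i \<subseteq> \<sigma> \<inter> {..\<rho> i}" if "i \<le> m" for i
    using blocks(1) that unfolding len .
  have B_Suc: "\<alpha> (Suc i) (\<rho> i) \<le> card (B (Suc i))" if "i < m" for i
    using blocks(4)[of i] that by (simp del: upt_Suc)
  note disj = blocks(2)[unfolded len] and B_0 = blocks(3) and \<rho> = blocks(5) blocks(6)[unfolded len]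
  have \<rho>_pos: "0 < \<rho> i" if "i \<le> m" for i
    using that
  proof (induction i)
    case (Suc i)
    with \<rho>(2)[of i] show ?case by simp
  qed (use \<rho>(1) in simp)
  have "\<forall>r. (\<forall>i\<le>m. 0 < r i) \<and> (\<forall>i<m. r i \<le> r (Suc i)) \<longrightarrow>
      (\<exists>Z. X = (\<Union>i\<le>m. Z i) \<and> scale_dim_le (Z 0) d (real (r 0)) (n + 1 - 1) \<and>
        (\<forall>i\<in>{1..m}. scale_dim_le (Z i) d (real (r i)) (\<alpha> i (r (i - 1)) - 1)))"
    using profile unfolding integral_APD_profile_def by (elim conjE)
  with \<rho>_pos \<rho>(2) obtain Z where Z: "X = (\<Union>i\<le>m. Z i)"
    and Z_0: "scale_dim_le (Z 0) d (\<rho> 0) (n + 1 - 1)"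
    and Z_Suc: "\<forall>i\<in>{1..m}. scale_dim_le (Z i) d (\<rho> i) (\<alpha> i (\<rho> (i - 1)) - 1)"
    by blast
  have "\<exists>W. Z i = (\<Union>b\<in>B i. W b) \<and> (\<forall>b\<in>B i. splits_at_scale d (\<rho> i) (W b))"
    if "i \<le> m" for i
  proof (cases i)
    case 0
    show ?thesis
      unfolding 0 using Z_0 B_0 \<rho>_pos[of 0] zero Z
      by (intro scale_dim_le_imp_cover[of _ _ _ "n + 1"]) auto
  next
    case (Suc j)
    have "0 < \<alpha> (Suc j) (\<rho> j)"
      using profile that Suc \<rho>_pos[of j] by (auto simp: integral_APD_profile_def)
    then show ?thesis
      using Z_Suc[rule_format, of i] B_Suc[of j] \<rho>_pos[of i] zero Z that Suc
      by (intro scale_dim_le_imp_cover[of _ _ _ "\<alpha> (Suc j) (\<rho> j)"]) auto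
  qed
  then obtain W where W: "\<And>i. i \<le> m \<Longrightarrow> Z i = (\<Union>b\<in>B i. W i b)"
    "\<And>i b. i \<le> m \<Longrightarrow> b \<in> B i \<Longrightarrow> splits_at_scale d (\<rho> i) (W i b)"
    by metis
  \<comment> \<open>The blocks are disjoint, so at most one set enters the union; it is empty for \<open>b\<close> outside
    all blocks.\<close>
  define Y where "Y b = (\<Union>i\<in>{i. i \<le> m \<and> b \<in> B i}. W i b)" for b
  have Y_eq: "Y b = W i b" if "i \<le> m" "b \<in> B i" for i b
  proof -
    have "{i. i \<le> m \<and> b \<in> B i} = {i}"
      using that disj by (auto simp: disjoint_family_on_def)
    then show ?thesis by (simp add: Y_def)
  qed
  have "splits_at_scale d (real b) (Y b)" for b
  proof (cases "\<exists>i\<le>m. b \<in> B i")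
    case True
    then obtain i where i: "i \<le> m" "b \<in> B i" by blast
    then have "real b \<le> real (\<rho> i)"
      using B by fastforce
    with W(2)[OF i] Y_eq[OF i] show ?thesis
      by (auto intro: splits_at_scale_mono)
  next
    case False
    then have "Y b = {}"
      by (auto simp: Y_def)
    then show ?thesis by (simp add: splits_at_scale_empty)
  qed
  moreover have "X = (\<Union>b\<in>\<sigma>. Y b)"
    using B by (force simp: Z W(1) Y_def)
  ultimately show False
    using \<sigma> unfolding non_covering_def splits_at_scale_def by blast
qed

theorem theorem3p4:
  fixes n m :: nat
    and X :: "'a set"
    and d :: "'a \<Rightarrow> 'a \<Rightarrow> ennreal"
  assumes "m > 0"
    and "inf_pseudometric X d"
    and "\<exists>\<alpha>. integral_APD_profile X d m (n + 1) \<alpha>"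
  shows "trasdim X d \<le> Fin (copies_of_omega m + ord_of_nat n)"
proof -
  from assms(3) obtain \<alpha> where \<alpha>: "integral_APD_profile X d m (n + 1) \<alpha>" by blast
  have "Ord_le {0<..} (non_covering X d)
      (copies_of_omega (length (map \<alpha> [1..<Suc m])) + ord_of_nat n)"
  proof (rule Ord_le_if_no_large)
    show "non_covering X d \<subseteq> Fin_subsets {0<..}"
      by (auto simp: non_covering_def)
    show "\<not> large (map \<alpha> [1..<Suc m]) (Suc n) 1 \<sigma>" if "\<sigma> \<in> non_covering X d" for \<sigma>
      using large_not_non_covering[of X d m n \<alpha> \<sigma>] that \<alpha> assms(2)
      by (auto simp: inf_pseudometric_def)
    show "0 < f s" if "f \<in> set (map \<alpha> [1..<Suc m])" "0 < s" for f s
      using that \<alpha> by (auto simp: integral_APD_profile_def)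
  qed
  then show ?thesis
    by (simp add: trasdim_def Ord_le_iff del: upt_Suc)
qed

end
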